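(* There is a functor $E\colon\mathsf{StrPos}\to\mathsf{FinF}$ defined on objects by sending a poset $(P,\leq)$ to $(P,\mathcal{U})$, where $\mathcal{U}$ is the set of artinian and narrow subsets of $P$, and on arrows by $E(f)=f$.
   Context: For a set $X$ and a collection $\mathcal{U}\subseteq\mathcal{P}(X)$ of subsets, put $\mathcal{U}^\perp=\{u'\subseteq X \mid u'\cap u \text{ is finite for all } u\in\mathcal{U}\}$. A finiteness space is a pair $(X,\mathcal{U})$ with $X$ a set and $\mathcal{U}\subseteq\mathcal{P}(X)$ such that $\mathcal{U}^{\perp\perp}=\mathcal{U}$. The category $\mathsf{FinF}$ has finiteness spaces as objects; a morphism $(X,\mathcal{U})\to(Y,\mathcal{V})$ is a (total) function $f\colon X\to Y$ such that (1) $f(u)\in\mathcal{V}$ for all $u\in\mathcal{U}$, and (2) $f^{-1}(v')\in\mathcal{U}^\perp$ for all $v'\in\mathcal{V}^\perp$. A map $f\colon P\to Q$ of posets is strict if $p<p'$ implies $f(p)<f(p')$. $\mathsf{StrPos}$ is the category of posets and strict maps. A poset is artinian if every strictly descending chain in it is finite, and narrow if every subset of pairwise incomparable elements is finite; a subset of a poset is artinian or narrow if it is so for the induced order. *)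

theory Defs
  imports Main "HOL-Library.FuncSet"
begin

section \<open>Categories and functors\<close>

text \<open>
  Categories are presented by hom-sets. Hom-sets of different pairs of objects need not be
  disjoint, so identities, composition and the arrow part of a functor take the objects
  involved as arguments: \<open>Comp C X Y Z g f\<close> is the composite of \<open>f \<in> Hom C X Y\<close> and
  \<open>g \<in> Hom C Y Z\<close>.
\<close>

record ('o, 'm) category_data =
  Ob :: "'o set"
  Hom :: "'o \<Rightarrow> 'o \<Rightarrow> 'm set"
  Id :: "'o \<Rightarrow> 'm"
  Comp :: "'o \<Rightarrow> 'o \<Rightarrow> 'o \<Rightarrow> 'm \<Rightarrow> 'm \<Rightarrow> 'm"

locale category =
  fixes C :: "('o, 'm) category_data"
  assumes Id_in_Hom: "X \<in> Ob C \<Longrightarrow> Id C X \<in> Hom C X X"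
    and Comp_in_Hom: "\<lbrakk>X \<in> Ob C; Y \<in> Ob C; Z \<in> Ob C; f \<in> Hom C X Y; g \<in> Hom C Y Z\<rbrakk>
      \<Longrightarrow> Comp C X Y Z g f \<in> Hom C X Z"
    and Comp_Id_right: "\<lbrakk>X \<in> Ob C; Y \<in> Ob C; f \<in> Hom C X Y\<rbrakk>
      \<Longrightarrow> Comp C X X Y f (Id C X) = f"
    and Comp_Id_left: "\<lbrakk>X \<in> Ob C; Y \<in> Ob C; f \<in> Hom C X Y\<rbrakk>
      \<Longrightarrow> Comp C X Y Y (Id C Y) f = f"
    and Comp_assoc: "\<lbrakk>W \<in> Ob C; X \<in> Ob C; Y \<in> Ob C; Z \<in> Ob C;
        f \<in> Hom C W X; g \<in> Hom C X Y; h \<in> Hom C Y Z\<rbrakk>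
      \<Longrightarrow> Comp C W Y Z h (Comp C W X Y g f) = Comp C W X Z (Comp C X Y Z h g) f"

record ('o1, 'm1, 'o2, 'm2) functor_data =
  on_ob :: "'o1 \<Rightarrow> 'o2"
  on_hom :: "'o1 \<Rightarrow> 'o1 \<Rightarrow> 'm1 \<Rightarrow> 'm2"

locale is_functor = source: category C + target: category D
  for C :: "('o1, 'm1) category_data" and D :: "('o2, 'm2) category_data" +
  fixes F :: "('o1, 'm1, 'o2, 'm2) functor_data"
  assumes on_ob_in_Ob: "X \<in> Ob C \<Longrightarrow> on_ob F X \<in> Ob D"
    and on_hom_in_Hom: "\<lbrakk>X \<in> Ob C; Y \<in> Ob C; f \<in> Hom C X Y\<rbrakk>
      \<Longrightarrow> on_hom F X Y f \<in> Hom D (on_ob F X) (on_ob F Y)"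
    and on_hom_Id: "X \<in> Ob C \<Longrightarrow> on_hom F X X (Id C X) = Id D (on_ob F X)"
    and on_hom_Comp: "\<lbrakk>X \<in> Ob C; Y \<in> Ob C; Z \<in> Ob C; f \<in> Hom C X Y; g \<in> Hom C Y Z\<rbrakk>
      \<Longrightarrow> on_hom F X Z (Comp C X Y Z g f) =
          Comp D (on_ob F X) (on_ob F Y) (on_ob F Z) (on_hom F Y Z g) (on_hom F X Y f)"


section \<open>Finiteness spaces\<close>

definition perp :: "'a set \<Rightarrow> 'a set set \<Rightarrow> 'a set set" where
  "perp X U = {u'. u' \<subseteq> X \<and> (\<forall>u\<in>U. finite (u' \<inter> u))}"

type_synonym 'a fin_space = "'a set \<times> 'a set set"

definition finiteness_space :: "'a fin_space \<Rightarrow> bool" where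
  "finiteness_space = (\<lambda>(X, U). U \<subseteq> Pow X \<and> perp X (perp X U) = U)"

text \<open>
  In both categories below a function with domain \<open>X\<close> is an extensional HOL function
  (\<open>undefined\<close> outside \<open>X\<close>), so that equality of arrows is equality of functions on \<open>X\<close>.
\<close>

definition finF_hom :: "'a fin_space \<Rightarrow> 'a fin_space \<Rightarrow> ('a \<Rightarrow> 'a) set" where
  "finF_hom = (\<lambda>(X, U) (Y, V). {f \<in> X \<rightarrow>\<^sub>E Y.
     (\<forall>u\<in>U. f ` u \<in> V) \<and> (\<forall>v'\<in>perp Y V. f -` v' \<inter> X \<in> perp X U)})"

definition FinF :: "('a fin_space, 'a \<Rightarrow> 'a) category_data" where
  "FinF = \<lparr>Ob = {S. finiteness_space S}, Hom = finF_hom,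
     Id = (\<lambda>(X, U). \<lambda>x\<in>X. x), Comp = (\<lambda>(X, U) S T g f. compose X g f)\<rparr>"


section \<open>Posets and strict maps\<close>

text \<open>A poset is a carrier together with its reflexive order: \<open>(x, y) \<in> r\<close> means \<open>x \<le> y\<close>.\<close>

type_synonym 'a poset = "'a set \<times> 'a rel"

definition is_poset :: "'a poset \<Rightarrow> bool" where
  "is_poset = (\<lambda>(P, r). partial_order_on P r)"

definition strict_less :: "'a rel \<Rightarrow> 'a \<Rightarrow> 'a \<Rightarrow> bool" where
  "strict_less r x y \<longleftrightarrow> (x, y) \<in> r \<and> x \<noteq> y"

definition strPos_hom :: "'a poset \<Rightarrow> 'a poset \<Rightarrow> ('a \<Rightarrow> 'a) set" where
  "strPos_hom = (\<lambda>(P, r) (Q, s). {f \<in> P \<rightarrow>\<^sub>E Q.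
     \<forall>p\<in>P. \<forall>p'\<in>P. strict_less r p p' \<longrightarrow> strict_less s (f p) (f p')})"

definition StrPos :: "('a poset, 'a \<Rightarrow> 'a) category_data" where
  "StrPos = \<lparr>Ob = {A. is_poset A}, Hom = strPos_hom,
     Id = (\<lambda>(P, r). \<lambda>x\<in>P. x), Comp = (\<lambda>(P, r) B C g f. compose P g f)\<rparr>"

text \<open>
  Descending chains \<open>x\<^sub>0 > x\<^sub>1 > \<dots>\<close> are sequences, so all of them are finite iff there is no
  infinite one.
\<close>

definition artinian :: "'a poset \<Rightarrow> bool" where
  "artinian = (\<lambda>(P, r). \<not> (\<exists>x :: nat \<Rightarrow> 'a. \<forall>n. x n \<in> P \<and> strict_less r (x (Suc n)) (x n)))"

definition narrow :: "'a poset \<Rightarrow> bool" where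
  "narrow = (\<lambda>(P, r). \<forall>A\<subseteq>P. pairwise (\<lambda>x y. (x, y) \<notin> r \<and> (y, x) \<notin> r) A \<longrightarrow> finite A)"

definition artinian_subset :: "'a poset \<Rightarrow> 'a set \<Rightarrow> bool" where
  "artinian_subset = (\<lambda>(P, r) u. u \<subseteq> P \<and> artinian (u, Restr r u))"

definition narrow_subset :: "'a poset \<Rightarrow> 'a set \<Rightarrow> bool" where
  "narrow_subset = (\<lambda>(P, r) u. u \<subseteq> P \<and> narrow (u, Restr r u))"

end

theory Submission
  imports Defs "HOL-Library.Ramsey"
begin

text \<open>
  By Ramsey's theorem a subset of a poset is artinian and narrow iff every injective sequence in it
  has indices \<open>i < j\<close> with \<open>x i < x j\<close>. So the artinian and narrow subsets are the \<open>perp\<close> of the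
  ranges of the injective sequences violating this, and every \<open>perp\<close> is a finiteness structure.
  A sequence violating the condition in the image of a strict map lifts to one in the source, and
  the fibres of a strict map are antichains, hence meet every narrow subset in a finite set.
\<close>

section \<open>Orthogonality of families of subsets\<close>

lemma perp_antimono: "U \<subseteq> V \<Longrightarrow> perp X V \<subseteq> perp X U"
  unfolding perp_def by blast

lemma subset_perp_perp:
  assumes "U \<subseteq> Pow X"
  shows "U \<subseteq> perp X (perp X U)"
  using assms by (auto simp: perp_def Int_commute)

text \<open>\<open>perp X\<close> forms an antitone Galois connection with itself, so applying it
  three times amounts to applying it once.\<close>

lemma finiteness_space_perp:
  assumes "W \<subseteq> Pow X"
  shows "finiteness_space (X, perp X W)"
proof -
  have "perp X W \<subseteq> Pow X"
    unfolding perp_def by blast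
  then show ?thesis
    using perp_antimono[OF subset_perp_perp[OF assms]] subset_perp_perp[of "perp X W" X]
    by (simp add: finiteness_space_def subset_antisym)
qed

section \<open>Bad sequences and Ramsey's theorem\<close>

text \<open>Injectivity makes every range infinite, and makes \<open>strict_less r\<close> coincide
  with membership in \<open>r\<close> at distinct indices.\<close>

definition bad_seq :: "'a rel \<Rightarrow> (nat \<Rightarrow> 'a) \<Rightarrow> bool" where
  "bad_seq r x \<longleftrightarrow> inj x \<and> (\<forall>i j. i < j \<longrightarrow> \<not> strict_less r (x i) (x j))"

definition artinian_narrow_subsets :: "'a poset \<Rightarrow> 'a set set" where
  "artinian_narrow_subsets A = {u. artinian_subset A u \<and> narrow_subset A u}"

lemma bad_seq_subseq:
  assumes "bad_seq r x" and "strict_mono k"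
  shows "bad_seq r (x \<circ> k)"
  using assms by (auto simp: bad_seq_def strict_mono_less strict_mono_imp_inj_on intro: inj_compose)

lemma strict_less_trans:
  assumes "is_poset (P, r)" and "strict_less r a b" and "strict_less r b c"
  shows "strict_less r a c"
proof -
  have "trans r" "antisym r"
    using assms(1) by (auto simp: is_poset_def dest: partial_order_onD)
  then show ?thesis
    using assms(2,3) unfolding strict_less_def by (meson transD antisymD)
qed

lemma strict_less_asym:
  assumes "is_poset (P, r)" and "strict_less r a b"
  shows "\<not> strict_less r b a"
  using assms strict_less_trans strict_less_def by metis

lemma descending_seq_bad:
  assumes "is_poset (P, r)" and desc: "\<And>n. strict_less r (x (Suc n)) (x n)"
  shows "bad_seq r x"
proof -
  have less: "strict_less r (x j) (x i)" if "i < j" for i j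
    using that
  proof (induction j)
    case (Suc j)
    then show ?case
      using desc strict_less_trans[OF assms(1)] by (metis less_antisym)
  qed simp
  \<comment> \<open>Values at distinct indices are strictly related, hence distinct.\<close>
  then have "inj x"
    by (metis injI linorder_neqE_nat strict_less_def)
  then show ?thesis
    using less strict_less_asym[OF assms(1)] by (auto simp: bad_seq_def)
qed

lemma antichain_contains_bad_seq:
  assumes "infinite A" and "pairwise (\<lambda>x y. (x, y) \<notin> r \<and> (y, x) \<notin> r) A"
  obtains x where "range x \<subseteq> A" and "bad_seq r x"
proof -
  obtain x :: "nat \<Rightarrow> 'a" where x: "inj x" "range x \<subseteq> A"
    using infinite_countable_subset[OF assms(1)] by blast
  have "bad_seq r x"
    using x assms(2) unfolding bad_seq_def strict_less_def pairwise_def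
    by (metis range_subsetD)
  with x(2) show thesis by (rule that)
qed

text \<open>Badness leaves two cases for \<open>i < j\<close>: \<open>x j\<close> lies below
  \<open>x i\<close>, or the two are incomparable. Ramsey's theorem makes one case hold uniformly on
  an infinite set of indices.\<close>

lemma bad_seq_descending_or_antichain:
  assumes "bad_seq r x"
  obtains k :: "nat \<Rightarrow> nat" where "strict_mono k"
      and "(\<forall>n. strict_less r (x (k (Suc n))) (x (k n))) \<or>
        pairwise (\<lambda>a b. (a, b) \<notin> r \<and> (b, a) \<notin> r) (range (x \<circ> k))"
proof -
  \<comment> \<open>\<open>Ramsey2\<close> colours unordered pairs of indices; \<open>Min\<close>
    and \<open>Max\<close> recover their order. Colour 0 marks a descent, colour 1
    incomparability.\<close>
  define c :: "nat set \<Rightarrow> nat" where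
    "c S = (if (x (Max S), x (Min S)) \<in> r then 0 else 1)" for S
  have c: "c {i, j} = (if (x j, x i) \<in> r then 0 else 1)" if "i < j" for i j
    using that by (simp add: c_def)
  have "\<exists>Y t. Y \<subseteq> UNIV \<and> infinite Y \<and> t < 2 \<and> (\<forall>i\<in>Y. \<forall>j\<in>Y. i \<noteq> j \<longrightarrow> c {i, j} = t)"
    by (rule Ramsey2) (auto simp: c_def)
  then obtain Y t where Y: "infinite Y" and t: "\<forall>i\<in>Y. \<forall>j\<in>Y. i \<noteq> j \<longrightarrow> c {i, j} = t"
    by (elim exE conjE)
  \<comment> \<open>Enumerating the homogeneous set in increasing order turns it into a
    subsequence.\<close>
  define k where "k = enumerate Y"
  have mono: "strict_mono k"
    unfolding k_def using Y by (rule strict_mono_enumerate)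
  have inY: "k n \<in> Y" for n
    unfolding k_def using Y by (rule enumerate_in_set)
  have lt: "k i < k j" if "i < j" for i j
    using mono that by (rule strict_monoD)
  have ct: "c {k i, k j} = t" if "i < j" for i j
    using t inY lt[OF that] by simp
  have inj: "x i = x j \<longleftrightarrow> i = j" for i j
    using assms by (auto simp: bad_seq_def inj_eq)
  show thesis
  proof (rule that[OF mono], cases "t = 0")
    case True
    have "strict_less r (x (k (Suc n))) (x (k n))" for n
      using ct[of n "Suc n"] c[OF lt, of n "Suc n"] lt[of n "Suc n"] True
      by (auto simp: strict_less_def inj split: if_splits)
    then show "(\<forall>n. strict_less r (x (k (Suc n))) (x (k n))) \<or>
        pairwise (\<lambda>a b. (a, b) \<notin> r \<and> (b, a) \<notin> r) (range (x \<circ> k))"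
      by blast
  next
    case False
    have "(x (k i), x (k j)) \<notin> r \<and> (x (k j), x (k i)) \<notin> r" if "i < j" for i j
    proof
      \<comment> \<open>Ascents are excluded by badness, whatever the colour; the colour excludes
        descents.\<close>
      show "(x (k i), x (k j)) \<notin> r"
        using assms lt[OF that] by (auto simp: bad_seq_def strict_less_def inj)
      show "(x (k j), x (k i)) \<notin> r"
        using ct[OF that] c[OF lt[OF that]] False by auto
    qed
    then have "(x (k i), x (k j)) \<notin> r" if "i \<noteq> j" for i j
      using that by (cases i j rule: linorder_cases) auto
    then have "pairwise (\<lambda>a b. (a, b) \<notin> r \<and> (b, a) \<notin> r) (range (x \<circ> k))"
      by (clarsimp simp: pairwise_def) metis
    then show "(\<forall>n. strict_less r (x (k (Suc n))) (x (k n))) \<or>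
        pairwise (\<lambda>a b. (a, b) \<notin> r \<and> (b, a) \<notin> r) (range (x \<circ> k))"
      by blast
  qed
qed

section \<open>Artinian and narrow subsets described by bad sequences\<close>

lemma mem_artinian_narrow_subsets_iff:
  assumes "is_poset (P, r)"
  shows "u \<in> artinian_narrow_subsets (P, r) \<longleftrightarrow>
    u \<subseteq> P \<and> (\<forall>x. range x \<subseteq> u \<longrightarrow> \<not> bad_seq r x)"
proof
  assume u: "u \<in> artinian_narrow_subsets (P, r)"
  have no_desc: "\<not> (\<forall>n. y n \<in> u \<and> strict_less r (y (Suc n)) (y n))" for y
    using u unfolding artinian_narrow_subsets_def artinian_subset_def artinian_def
      strict_less_def by auto
  have no_antichain: "finite A"
    if "A \<subseteq> u" "pairwise (\<lambda>a b. (a, b) \<notin> r \<and> (b, a) \<notin> r) A" for A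
    using u that by (auto simp: artinian_narrow_subsets_def narrow_subset_def narrow_def
        pairwise_def)
  have "\<not> bad_seq r x" if "range x \<subseteq> u" for x
  proof
    assume bad: "bad_seq r x"
    then obtain k where k: "strict_mono k"
      "(\<forall>n. strict_less r (x (k (Suc n))) (x (k n))) \<or>
        pairwise (\<lambda>a b. (a, b) \<notin> r \<and> (b, a) \<notin> r) (range (x \<circ> k))"
      by (rule bad_seq_descending_or_antichain)
    \<comment> \<open>An infinite range cannot be an antichain in the narrow set \<open>u\<close>,
      so only the descending alternative survives.\<close>
    have "infinite (range (x \<circ> k))"
      using bad_seq_subseq[OF bad k(1)] range_inj_infinite unfolding bad_seq_def by blast
    then have "\<forall>n. strict_less r (x (k (Suc n))) (x (k n))"
      using k(2) no_antichain[of "range (x \<circ> k)"] \<open>range x \<subseteq> u\<close> by auto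
    then show False
      using no_desc[of "x \<circ> k"] \<open>range x \<subseteq> u\<close> by auto
  qed
  moreover have "u \<subseteq> P"
    using u by (simp add: artinian_narrow_subsets_def artinian_subset_def)
  ultimately show "u \<subseteq> P \<and> (\<forall>x. range x \<subseteq> u \<longrightarrow> \<not> bad_seq r x)"
    by blast
next
  assume u: "u \<subseteq> P \<and> (\<forall>x. range x \<subseteq> u \<longrightarrow> \<not> bad_seq r x)"
  have "artinian (u, Restr r u)"
    unfolding artinian_def
  proof (simp only: prod.case, intro notI, elim exE)
    fix x :: "nat \<Rightarrow> 'a"
    assume desc: "\<forall>n. x n \<in> u \<and> strict_less (Restr r u) (x (Suc n)) (x n)"
    then have "bad_seq r x"
      by (intro descending_seq_bad[OF assms]) (auto simp: strict_less_def)
    then show False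
      using u desc by blast
  qed
  moreover have "narrow (u, Restr r u)"
    unfolding narrow_def
  proof (simp only: prod.case, intro allI impI, rule ccontr)
    fix A
    assume A: "A \<subseteq> u" "infinite A"
      and "pairwise (\<lambda>x y. (x, y) \<notin> Restr r u \<and> (y, x) \<notin> Restr r u) A"
    then have "pairwise (\<lambda>x y. (x, y) \<notin> r \<and> (y, x) \<notin> r) A"
      unfolding pairwise_def by blast
    then obtain x where "range x \<subseteq> A" "bad_seq r x"
      using antichain_contains_bad_seq[OF A(2)] by blast
    then show False
      using u A(1) by blast
  qed
  ultimately show "u \<in> artinian_narrow_subsets (P, r)"
    using u by (simp add: artinian_narrow_subsets_def artinian_subset_def narrow_subset_def)
qed

lemma artinian_narrow_subsets_eq_perp:
  assumes "is_poset (P, r)"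
  shows "artinian_narrow_subsets (P, r) = perp P {range x |x. range x \<subseteq> P \<and> bad_seq r x}"
proof (rule set_eqI)
  fix u
  have "(\<exists>y. range y \<subseteq> u \<and> bad_seq r y) \<longleftrightarrow>
      (\<exists>x. range x \<subseteq> P \<and> bad_seq r x \<and> infinite (u \<inter> range x))" if "u \<subseteq> P"
  proof
    assume "\<exists>y. range y \<subseteq> u \<and> bad_seq r y"
    then obtain y where y: "range y \<subseteq> u" "bad_seq r y" by blast
    then have "infinite (u \<inter> range y)"
      by (simp add: Int_absorb1 bad_seq_def range_inj_infinite)
    then show "\<exists>x. range x \<subseteq> P \<and> bad_seq r x \<and> infinite (u \<inter> range x)"
      using y \<open>u \<subseteq> P\<close> by blast
  next
    assume "\<exists>x. range x \<subseteq> P \<and> bad_seq r x \<and> infinite (u \<inter> range x)"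
    then obtain x where x: "bad_seq r x" "infinite (u \<inter> range x)" by blast
    have "u \<inter> range x = x ` (x -` u)" by blast
    \<comment> \<open>Listing these indices in increasing order gives a subsequence inside
      \<open>u\<close>, which is again bad.\<close>
    then have inf: "infinite (x -` u)"
      using x(2) by (metis finite_imageI)
    let ?k = "enumerate (x -` u)"
    have "bad_seq r (x \<circ> ?k)"
      using x(1) strict_mono_enumerate[OF inf] by (rule bad_seq_subseq)
    moreover have "range (x \<circ> ?k) \<subseteq> u"
      using enumerate_in_set[OF inf] by auto
    ultimately show "\<exists>y. range y \<subseteq> u \<and> bad_seq r y" by blast
  qed
  then show "u \<in> artinian_narrow_subsets (P, r) \<longleftrightarrow>
      u \<in> perp P {range x |x. range x \<subseteq> P \<and> bad_seq r x}"
    unfolding mem_artinian_narrow_subsets_iff[OF assms] perp_def by blast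
qed

section \<open>The functor on objects and on arrows\<close>

lemma artinian_narrow_finiteness_space:
  assumes "is_poset (P, r)"
  shows "finiteness_space (P, artinian_narrow_subsets (P, r))"
  unfolding artinian_narrow_subsets_eq_perp[OF assms]
  by (rule finiteness_space_perp) auto

lemma strPos_hom_finF_hom:
  assumes P: "is_poset (P, r)" and Q: "is_poset (Q, s)" and f: "f \<in> strPos_hom (P, r) (Q, s)"
  shows "f \<in> finF_hom (P, artinian_narrow_subsets (P, r)) (Q, artinian_narrow_subsets (Q, s))"
proof -
  have f_in: "f \<in> P \<rightarrow>\<^sub>E Q"
    and f_strict: "\<And>p p'. \<lbrakk>p \<in> P; p' \<in> P; strict_less r p p'\<rbrakk> \<Longrightarrow> strict_less s (f p) (f p')"
    using f by (auto simp: strPos_hom_def)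
  have image: "f ` u \<in> artinian_narrow_subsets (Q, s)"
    if u: "u \<in> artinian_narrow_subsets (P, r)" for u
    unfolding mem_artinian_narrow_subsets_iff[OF Q]
  proof (intro conjI allI impI notI)
    have "u \<subseteq> P"
      using u by (simp add: mem_artinian_narrow_subsets_iff[OF P])
    then show "f ` u \<subseteq> Q"
      using f_in by auto
    fix y
    assume y: "range y \<subseteq> f ` u" "bad_seq s y"
    then have "\<forall>n. \<exists>a\<in>u. f a = y n" by (metis image_iff range_subsetD)
    then obtain x where x: "\<And>n. x n \<in> u" "\<And>n. f (x n) = y n" by metis
    \<comment> \<open>Any choice of preimages works: a repetition in \<open>x\<close> would give one
      in \<open>y\<close>, and \<open>f\<close> would carry an ascent of \<open>x\<close> to an
      ascent of \<open>y\<close>.\<close>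
    have "bad_seq r x"
      unfolding bad_seq_def
    proof (intro conjI allI impI notI)
      show "inj x"
        using y(2) x(2) unfolding bad_seq_def by (metis injI injD)
      fix i j :: nat
      assume "i < j" "strict_less r (x i) (x j)"
      then show False
        using f_strict[of "x i" "x j"] x y(2) \<open>u \<subseteq> P\<close> by (auto simp: bad_seq_def)
    qed
    then show False
      using u x(1) by (auto simp: mem_artinian_narrow_subsets_iff[OF P])
  qed
  have preimage: "f -` v' \<inter> P \<in> perp P (artinian_narrow_subsets (P, r))"
    if v': "v' \<in> perp Q (artinian_narrow_subsets (Q, s))" for v'
    unfolding perp_def
  proof (clarsimp, rule ccontr)
    fix u
    assume u: "u \<in> artinian_narrow_subsets (P, r)" and inf: "infinite (f -` v' \<inter> P \<inter> u)"
    \<comment> \<open>The first condition, already proved for \<open>f\<close>, bounds the values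
      taken on the infinite set, so by pigeonhole some fibre is infinite.\<close>
    have "finite (v' \<inter> f ` u)"
      using v' image[OF u] by (auto simp: perp_def)
    then have "finite (f ` (f -` v' \<inter> P \<inter> u))"
      by (rule rev_finite_subset) auto
    then obtain y where "infinite (f -` {y} \<inter> (f -` v' \<inter> P \<inter> u))"
      using inf by (rule inf_img_fin_domE')
    then obtain x :: "nat \<Rightarrow> 'a" where x: "inj x" "range x \<subseteq> f -` {y} \<inter> (f -` v' \<inter> P \<inter> u)"
      using infinite_countable_subset by blast
    have mem: "x n \<in> P" "f (x n) = y" for n
      using range_subsetD[OF x(2), of n] by auto
    \<comment> \<open>A strict relation inside the fibre over \<open>y\<close> would put
      \<open>y\<close> strictly below itself.\<close>
    have "\<not> strict_less r (x i) (x j)" for i j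
      using f_strict[OF mem(1) mem(1), of i j] by (auto simp: mem(2) strict_less_def[of s])
    then have "bad_seq r x"
      using x(1) by (simp add: bad_seq_def)
    then show False
      using u x(2) by (auto simp: mem_artinian_narrow_subsets_iff[OF P])
  qed
  show ?thesis
    using f_in image preimage by (auto simp: finF_hom_def)
qed

section \<open>Category laws\<close>

lemma category_StrPos: "category (StrPos :: ('a poset, 'a \<Rightarrow> 'a) category_data)"
proof
  fix X Y Z :: "'a poset" and f g :: "'a \<Rightarrow> 'a"
  assume "f \<in> Hom StrPos X Y" "g \<in> Hom StrPos Y Z"
  then show "Comp StrPos X Y Z g f \<in> Hom StrPos X Z"
    by (cases X; cases Y; cases Z)
      (auto simp: StrPos_def strPos_hom_def compose_def PiE_iff)
next
  fix W X Y Z :: "'a poset" and f g h :: "'a \<Rightarrow> 'a"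
  \<comment> \<open>Both composites are \<open>undefined\<close> off the carrier of
    \<open>W\<close>. On it they agree because \<open>f\<close> lands in the carrier of
    \<open>X\<close>, where the composite of \<open>h\<close> and \<open>g\<close> has its true
    value.\<close>
  assume "f \<in> Hom StrPos W X"
  then show "Comp StrPos W Y Z h (Comp StrPos W X Y g f) =
      Comp StrPos W X Z (Comp StrPos X Y Z h g) f"
    by (cases W; cases X; cases Y)
      (auto simp: StrPos_def strPos_hom_def PiE_iff Pi_iff compose_def restrict_def)
qed (auto simp: StrPos_def strPos_hom_def compose_def restrict_def PiE_iff extensional_def fun_eq_iff)

lemma category_FinF: "category (FinF :: ('a fin_space, 'a \<Rightarrow> 'a) category_data)"
proof
  fix S :: "'a fin_space"
  assume S: "S \<in> Ob FinF"
  obtain X U where XU: "S = (X, U)" by (cases S)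
  have "(\<lambda>x\<in>X. x) ` u = u" if "u \<subseteq> X" for u
    using that by (auto simp: image_iff subset_eq)
  moreover have "(\<lambda>x\<in>X. x) -` v \<inter> X = v \<inter> X" for v
    by auto
  moreover have "U \<subseteq> Pow X"
    using S XU by (simp add: FinF_def finiteness_space_def)
  moreover have "v \<inter> X = v" if "v \<in> perp X U" for v
    using that by (auto simp: perp_def)
  ultimately show "Id FinF S \<in> Hom FinF S S"
    using XU by (auto simp: FinF_def finF_hom_def subset_eq)
next
  fix S T R :: "'a fin_space" and f g :: "'a \<Rightarrow> 'a"
  assume fg: "f \<in> Hom FinF S T" "g \<in> Hom FinF T R"
  obtain X U Y V Z W where ST: "S = (X, U)" "T = (Y, V)" "R = (Z, W)"
    by (cases S; cases T; cases R)
  have f: "f \<in> X \<rightarrow>\<^sub>E Y" "\<And>u. u \<in> U \<Longrightarrow> f ` u \<in> V"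
      "\<And>v. v \<in> perp Y V \<Longrightarrow> f -` v \<inter> X \<in> perp X U"
    and g: "g \<in> Y \<rightarrow>\<^sub>E Z" "\<And>u. u \<in> V \<Longrightarrow> g ` u \<in> W"
      "\<And>v. v \<in> perp Z W \<Longrightarrow> g -` v \<inter> Y \<in> perp Y V"
    using fg ST by (auto simp: FinF_def finF_hom_def)
  \<comment> \<open>Only on \<open>X\<close> does \<open>compose X g f\<close> agree with
    \<open>g\<close> after \<open>f\<close>; the bound on \<open>u\<close> comes from
    \<open>U \<subseteq> Pow X\<close>.\<close>
  have "compose X g f ` u \<in> W" if "u \<in> U" "u \<subseteq> X" for u
  proof -
    have "compose X g f ` u = g ` f ` u"
      using that(2) by (auto simp: compose_def image_iff subset_eq)
    then show ?thesis using f(2) g(2) that(1) by simp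
  qed
  moreover have "compose X g f -` v \<inter> X \<in> perp X U" if "v \<in> perp Z W" for v
  proof -
    \<comment> \<open>Intersecting with \<open>Y\<close> loses nothing, since \<open>f\<close> maps
      \<open>X\<close> into \<open>Y\<close>.\<close>
    have "compose X g f -` v \<inter> X = f -` (g -` v \<inter> Y) \<inter> X"
      using f(1) by (auto simp: compose_def)
    then show ?thesis using f(3)[OF g(3)[OF that]] by (rule ssubst)
  qed
  moreover assume "S \<in> Ob FinF"
  then have "U \<subseteq> Pow X"
    using ST by (simp add: FinF_def finiteness_space_def)
  moreover have "compose X g f \<in> X \<rightarrow>\<^sub>E Z"
    using f(1) g(1) by (auto simp: compose_def PiE_iff)
  ultimately show "Comp FinF S T R g f \<in> Hom FinF S R"
    using ST by (auto simp: FinF_def finF_hom_def)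
next
  fix S T R Q :: "'a fin_space" and f g h :: "'a \<Rightarrow> 'a"
  assume "f \<in> Hom FinF S T"
  then show "Comp FinF S R Q h (Comp FinF S T R g f) =
      Comp FinF S T Q (Comp FinF T R Q h g) f"
    by (cases S; cases T; cases R)
      (auto simp: FinF_def finF_hom_def PiE_iff Pi_iff compose_def restrict_def)
qed (auto simp: FinF_def finF_hom_def compose_def restrict_def PiE_iff extensional_def fun_eq_iff)

theorem proposition4p4:
  shows "\<exists>E :: ('a poset, 'a \<Rightarrow> 'a, 'a fin_space, 'a \<Rightarrow> 'a) functor_data.
    is_functor StrPos FinF E \<and>
    (\<forall>P r. (P, r) \<in> Ob StrPos \<longrightarrow>
       on_ob E (P, r) = (P, {u. artinian_subset (P, r) u \<and> narrow_subset (P, r) u})) \<and>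
    (\<forall>A\<in>Ob StrPos. \<forall>B\<in>Ob StrPos. \<forall>f\<in>Hom StrPos A B. on_hom E A B f = f)"
proof -
  define E :: "('a poset, 'a \<Rightarrow> 'a, 'a fin_space, 'a \<Rightarrow> 'a) functor_data" where
    "E = \<lparr>on_ob = (\<lambda>A. (fst A, artinian_narrow_subsets A)), on_hom = (\<lambda>_ _ f. f)\<rparr>"
  have "is_functor StrPos FinF E"
    unfolding is_functor_def is_functor_axioms_def
    using artinian_narrow_finiteness_space strPos_hom_finF_hom
    \<comment> \<open>\<open>StrPos\<close> and \<open>FinF\<close> stay folded at first so that the
      category lemmas apply; unfolding them then settles the remaining functor conditions.\<close>
    by (auto simp: category_StrPos category_FinF E_def) (auto simp: StrPos_def FinF_def)
  then show ?thesis
    by (intro exI[of _ E]) (simp add: E_def artinian_narrow_subsets_def)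
qed

end
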